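(* Let $a,M$ be positive integers with $1\le a<M/2$ and $\gcd(a,M)=1$. Let $X\ge 16$ be a sufficiently large positive number, put $N:=\lfloor\sqrt{2\pi X}\rfloor$, and let $$q:=e^{-\tau+\frac{2\pi i h}{k_1}},$$ where $h,k_1$ are integers with $1\le h\le k_1\le N$ and $\gcd(h,k_1)=1$, and $\tau:=X^{-1}+2\pi i Y$ with $Y$ real, $|Y|\le\frac{1}{k_1N}$. Let $b$ be the unique integer between $1$ and $(k_1,M)$ such that $b\equiv -ha\pmod{(k_1,M)}$. Then $$\Psi_{a,M}(q)+\Psi_{M-a,M}(q)=\frac{\pi^2}{\tau}\,\frac{(k_1,M)^2}{k_1^2M}\left(\frac{2b\big(b-(k_1,M)\big)}{(k_1,M)^2}+\frac13\right)+2E_1,$$ where the error term $2E_1$ satisfies $$|\Re(E_1)|\ll_M X^{\frac12}\log X.$$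
   Context: $(k_1,M)$ denotes the greatest common divisor. For $|q|<1$ and a positive integer $c$, $$\Psi_{c,M}(q)=\log\frac{1}{(q^{2M+c};q^M)_\infty}=\sum_{m\ge 2}\sum_{\ell\ge1}\frac{q^{\ell(mM+c)}}{\ell},$$ where $(x;q)_\infty=\prod_{n\ge0}(1-xq^n)$. The notation $f\ll_M g$ means $|f|\le C|g|$ with a constant $C>0$ depending only on $M$. *)

theory Defs
  imports "HOL-Analysis.Analysis" "HOL-Number_Theory.Cong"
begin

definition qpoch_inf :: "complex \<Rightarrow> complex \<Rightarrow> complex" where
  "qpoch_inf x q = (\<Prod>n. 1 - x * q ^ n)"

text \<open>
  The branch of the logarithm of \<open>1 / qpoch_inf (q ^ (2 * M + c)) (q ^ M)\<close> is fixed by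
  the double series (which need not be the principal value of that logarithm).
  The lemmas below show that for \<open>norm q < 1\<close> the series converges absolutely and
  is indeed such a logarithm.
\<close>

definition Psi :: "nat \<Rightarrow> nat \<Rightarrow> complex \<Rightarrow> complex" where
  "Psi c M q = (\<Sum>\<^sub>\<infinity>m\<in>{2..}. \<Sum>\<^sub>\<infinity>l\<in>{1..}. q ^ (l * (m * M + c)) / of_nat l)"

lemma abs_summable_Psi:
  fixes q :: complex
  assumes q: "norm q < 1" and M: "0 < M"
  shows "(\<lambda>x. norm (case x of (m, l) \<Rightarrow> q ^ (l * (m * M + c)) / of_nat l))
           summable_on {2..} \<times> {1..}"
proof -
  define r where "r = norm q"
  have r: "0 \<le> r" "r < 1" using q by (auto simp: r_def)
  have geo: "(\<lambda>n::nat. r ^ n) summable_on UNIV"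
    using r by (intro norm_summable_imp_summable_on) (simp add: norm_power)
  have "(\<lambda>(m, l). r ^ (m - 1) * r ^ l) summable_on {2..} \<times> {1..}"
  proof (rule summable_on_SigmaI)
    fix m :: nat
    show "((\<lambda>l. case (m, l) of (m, l) \<Rightarrow> r ^ (m - 1) * r ^ l) has_sum
            r ^ (m - 1) * infsum (\<lambda>l. r ^ l) {1..}) {1..}"
      using summable_on_subset_banach[OF geo, of "{1..}"]
      by (auto intro!: has_sum_cmult_right has_sum_infsum)
  next
    have "(\<lambda>n::nat. r ^ n) summable_on {1..}"
      using summable_on_subset_banach[OF geo] by blast
    also have "{1..} = (\<lambda>m::nat. m - 1) ` {2..}"
    proof (intro set_eqI iffI)
      fix m :: nat
      assume "m \<in> {1..}"
      then show "m \<in> (\<lambda>m. m - 1) ` {2..}" by (intro image_eqI[of _ _ "m + 1"]) auto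
    qed auto
    finally have "(\<lambda>m::nat. r ^ (m - 1)) summable_on {2..}"
      by (subst (asm) summable_on_reindex) (auto simp: inj_on_def o_def)
    then show "(\<lambda>m::nat. r ^ (m - 1) * infsum (\<lambda>l. r ^ l) {1..}) summable_on {2..}"
      by (rule summable_on_cmult_left)
  qed (use r in auto)
  then show ?thesis
  proof (rule summable_on_comparison_test)
    fix x :: "nat \<times> nat"
    assume x: "x \<in> {2..} \<times> {1..}"
    obtain m l where [simp]: "x = (m, l)" by force
    have ml: "m \<ge> 2" "l \<ge> 1" using x by auto
    have "m - 1 + l \<le> l * m"
      using ml by (cases m; cases l) auto
    also have "\<dots> \<le> l * (m * M + c)"
    proof (rule mult_left_mono)
      have "m \<le> m * M" using M by (cases M) auto
      then show "m \<le> m * M + c" by (rule trans_le_add1)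
    qed simp
    finally have "r ^ (l * (m * M + c)) \<le> r ^ (m - 1 + l)"
      using r by (intro power_decreasing) auto
    moreover have "r ^ (l * (m * M + c)) / real l \<le> r ^ (l * (m * M + c)) / 1"
      using ml r by (intro divide_left_mono) auto
    ultimately show "norm (case x of (m, l) \<Rightarrow> q ^ (l * (m * M + c)) / of_nat l)
        \<le> (case x of (m, l) \<Rightarrow> r ^ (m - 1) * r ^ l)"
      by (simp add: norm_divide norm_power r_def power_add)
  qed auto
qed

lemma has_sum_log_series:
  fixes z :: complex
  assumes "norm z < 1"
  shows "((\<lambda>l::nat. z ^ l / of_nat l) has_sum - Ln (1 - z)) {1..}"
proof -
  have "summable (\<lambda>l. norm (z ^ l / of_nat l))"
  proof (rule summable_comparison_test')
    show "summable (\<lambda>l. norm z ^ l)" using assms by simp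
    show "norm (norm (z ^ n / of_nat n)) \<le> norm z ^ n" if "n \<ge> 1" for n
      using that divide_left_mono[of 1 "real n" "norm z ^ n"]
      by (simp add: norm_divide norm_power)
  qed
  moreover have "(\<lambda>l. z ^ l / of_nat l) sums - Ln (1 - z)"
    using sums_minus[OF Ln_series'[of "- z"]] assms by simp
  ultimately have "((\<lambda>l::nat. z ^ l / of_nat l) has_sum - Ln (1 - z)) UNIV"
    by (rule norm_summable_imp_has_sum)
  then show ?thesis
    by (rule has_sum_cong_neutral[THEN iffD1, rotated -1])
       (auto simp: not_le)
qed

lemma exp_Psi:
  fixes q :: complex
  assumes q: "norm q < 1" and M: "0 < M"
  shows "exp (Psi c M q) = 1 / qpoch_inf (q ^ (2 * M + c)) (q ^ M)"
proof -
  let ?z = "\<lambda>m. q ^ (m * M + c)"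
  have z: "norm (?z m) < 1" if "m \<ge> 1" for m
    using that q M by (simp add: norm_power power_less_one_iff)
  have inner: "(\<Sum>\<^sub>\<infinity>l\<in>{1..}. q ^ (l * (m * M + c)) / of_nat l) = - Ln (1 - ?z m)"
    if "m \<ge> 2" for m
    using infsumI[OF has_sum_log_series[OF z[of m]]] that
    by (simp add: power_mult mult.commute[of _ "m * M + c"])
  have "(\<lambda>m. \<Sum>\<^sub>\<infinity>l\<in>{1..}. q ^ (l * (m * M + c)) / of_nat l) summable_on {2..}"
    by (rule summable_on_Sigma_banach, rule abs_summable_summable, rule abs_summable_Psi[OF q M])
  then have "((\<lambda>m. \<Sum>\<^sub>\<infinity>l\<in>{1..}. q ^ (l * (m * M + c)) / of_nat l) has_sum Psi c M q) {2..}"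
    unfolding Psi_def by (rule has_sum_infsum)
  also have "?this \<longleftrightarrow> ((\<lambda>m. - Ln (1 - ?z m)) has_sum Psi c M q) {2..}"
    by (intro has_sum_cong inner) auto
  also have "{2..} = range (\<lambda>n::nat. n + 2)"
  proof (intro set_eqI iffI)
    fix m :: nat
    assume "m \<in> {2..}"
    then show "m \<in> range (\<lambda>n. n + 2)" by (intro range_eqI[of _ _ "m - 2"]) simp
  qed auto
  finally have "((\<lambda>n. - Ln (1 - ?z (n + 2))) has_sum Psi c M q) UNIV"
    by (subst (asm) has_sum_reindex) (auto simp: o_def inj_on_def)
  then have sums: "(\<lambda>n. - Ln (1 - ?z (n + 2))) sums Psi c M q"
    by (rule has_sum_imp_sums)
  have eq: "exp (Ln (1 - ?z (n + 2))) = 1 - q ^ (2 * M + c) * (q ^ M) ^ n" for n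
  proof -
    have "1 - ?z (n + 2) \<noteq> 0" using z[of "n + 2"] by auto
    then have *: "exp (Ln (1 - ?z (n + 2))) = 1 - ?z (n + 2)" by simp
    have **: "?z (n + 2) = q ^ (2 * M + c) * (q ^ M) ^ n"
      unfolding power_mult [symmetric] power_add [symmetric]
      by (rule arg_cong[of _ _ "(^) q"]) (simp add: algebra_simps)
    show ?thesis using * by (simp only: **)
  qed
  have "(\<lambda>n. Ln (1 - ?z (n + 2))) sums - Psi c M q"
    using sums_minus[OF sums] by simp
  from sums_imp_has_prod_exp[OF this]
  have "(\<lambda>n. 1 - q ^ (2 * M + c) * (q ^ M) ^ n) has_prod exp (- Psi c M q)"
    unfolding eq has_prod_def by simp
  then have "qpoch_inf (q ^ (2 * M + c)) (q ^ M) = exp (- Psi c M q)"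
    unfolding qpoch_inf_def by (rule has_prod_unique [symmetric])
  then show ?thesis by (simp add: exp_minus divide_inverse)
qed

end

theory Submission
  imports Defs
begin

text \<open>
  Summing the geometric series over \<open>m\<close> first gives
  \<open>Psi c M q = (\<Sum>l\<ge>1. q ^ (l * (2 * M + c)) / (1 - q ^ (l * M)) / l)\<close>.
  Terms with \<open>32 * l * M > N\<close> are at most \<open>X / l\<^sup>2\<close> and contribute \<open>O(X / N)\<close>.
  For smaller \<open>l\<close> there are two cases. If \<open>k\<close> does not divide \<open>l * M\<close>, then \<open>q ^ (l * M)\<close> is close
  to a \<open>k\<close>-th root of unity other than 1, and the term is at most \<open>k / l\<close>. If \<open>k\<close> divides \<open>l * M\<close>,
  then \<open>q ^ (l * M) = exp (- l * M * \<tau>)\<close>, and the simple pole of \<open>1 / (1 - exp (- z))\<close> at 0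
  produces a main term up to \<open>O(1 / l)\<close>. The main terms for \<open>a\<close> and \<open>M - a\<close> add up to a multiple of
  \<open>\<Sum>j\<ge>1. cos (2 * pi * j * b / g) / j\<^sup>2\<close> with \<open>g = gcd k M\<close>, a quadratic Bernoulli polynomial in
  \<open>b / g\<close>.
\<close>

subsection \<open>Elementary estimates\<close>

text \<open>The derivative of \<open>exp (- z)\<close> has norm at most 1 on the right half-plane,
  which is convex, so the mean value inequality between 0 and \<open>z\<close> applies.\<close>

lemma norm_exp_minus_diff_le:
  fixes z :: complex assumes "Re z \<ge> 0"
  shows "norm (1 - exp (- z)) \<le> norm z"
proof -
  have "norm (exp (- z) - exp (- 0)) \<le> 1 * norm (z - 0)"
  proof (rule field_differentiable_bound[where S = "{z. Re z \<ge> 0}" and f' = "\<lambda>z. - exp (- z)"])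
    show "convex {z. Re z \<ge> 0}" by (rule convex_halfspace_Re_ge)
  qed (use assms in \<open>auto intro!: derivative_eq_intros\<close>)
  then show ?thesis by (simp add: norm_minus_commute)
qed

lemma norm_exp_minus_linear_diff_le:
  fixes z :: complex assumes "Re z \<ge> 0"
  shows "norm (exp (- z) - 1 + z) \<le> norm z ^ 2"
proof -
  \<comment> \<open>The derivative \<open>1 - exp (- w)\<close> is at most \<open>norm w\<close> by
    the first-order bound. Intersecting the half-plane with the ball of radius \<open>norm z\<close>
    makes this bound uniform and keeps the region convex.\<close>
  have "norm ((exp (- z) + z) - (exp (- 0) + 0)) \<le> norm z * norm (z - 0)"
  proof (rule field_differentiable_bound
      [where S = "{w. Re w \<ge> 0} \<inter> cball 0 (norm z)" and f' = "\<lambda>z. 1 - exp (- z)"])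
    show "convex ({w. Re w \<ge> 0} \<inter> cball 0 (norm z))" 
      by (intro convex_Int convex_halfspace_Re_ge convex_cball)
    fix w assume "w \<in> {w. Re w \<ge> 0} \<inter> cball 0 (norm z)"
    then show "norm (1 - exp (- w)) \<le> norm z"
      using norm_exp_minus_diff_le[of w] by auto
  qed (use assms in \<open>auto intro!: derivative_eq_intros\<close>)
  then show ?thesis by (simp add: power2_eq_square algebra_simps)
qed

text \<open>The simple poles at 0 cancel, and the restriction on \<open>Im z\<close> keeps
  \<open>z\<close> away from the other zeros of \<open>1 - exp (- z)\<close>. The bound 3 on
  \<open>s\<close> accommodates \<open>(2 * M + c) / M\<close> for \<open>c \<le> M\<close>.\<close>

lemma exp_quotient_minus_inverse_bound:
  fixes z :: complex and s :: real
  assumes z: "Re z > 0" "\<bar>Im z\<bar> \<le> 1/4" and s: "0 \<le> s" "s \<le> 3"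
  shows "norm (exp (- (of_real s * z)) / (1 - exp (- z)) - 1 / z) \<le> 8"
proof (cases "norm z \<le> 1/2")
  case True
  have nz: "norm z > 0" using z by auto
  have "norm z - norm (exp (- z) - 1 + z) \<le> norm (1 - exp (- z))"
    using norm_triangle_ineq2[of z "exp (- z) - 1 + z"] by (simp add: algebra_simps)
  moreover have "norm (exp (- z) - 1 + z) \<le> norm z * (1/2)"
    using norm_exp_minus_linear_diff_le[of z] z True mult_left_mono[OF True, of "norm z"]
    by (simp add: power2_eq_square)
  ultimately have den: "norm z / 2 \<le> norm (1 - exp (- z))" by simp
  then have nz': "1 - exp (- z) \<noteq> 0" using nz by auto
  have "norm (1 - exp (- (of_real s * z))) \<le> s * norm z"
    using norm_exp_minus_diff_le[of "of_real s * z"] z s by (simp add: norm_mult)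
  also have "\<dots> \<le> 3 * norm z" using s by (intro mult_right_mono) auto
  finally have "norm (z * (1 - exp (- (of_real s * z)))) \<le> norm z * (3 * norm z)"
    unfolding norm_mult by (intro mult_left_mono) auto
  moreover have "norm (exp (- z) - 1 + z) \<le> norm z ^ 2"
    using norm_exp_minus_linear_diff_le[of z] z by simp
  ultimately have "norm ((exp (- z) - 1 + z) - z * (1 - exp (- (of_real s * z)))) \<le> 4 * norm z ^ 2"
    using norm_triangle_ineq4[of "exp (- z) - 1 + z" "z * (1 - exp (- (of_real s * z)))"]
    by (simp add: power2_eq_square)
  \<comment> \<open>Over the common denominator the first-order terms cancel: the numerator is at
    most \<open>4 * norm z ^ 2\<close> and the denominator at least \<open>norm z ^ 2 / 2\<close>,
    which gives 8.\<close>
  moreover have "exp (- (of_real s * z)) / (1 - exp (- z)) - 1 / z =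
      ((exp (- z) - 1 + z) - z * (1 - exp (- (of_real s * z)))) / (z * (1 - exp (- z)))"
    using nz nz' by (simp add: field_simps)
  ultimately have "norm (exp (- (of_real s * z)) / (1 - exp (- z)) - 1 / z) \<le> 
      4 * norm z ^ 2 / norm (z * (1 - exp (- z)))"
    by (simp add: norm_divide divide_right_mono)
  also have "\<dots> \<le> 4 * norm z ^ 2 / (norm z * (norm z / 2))"
    unfolding norm_mult using nz den by (intro divide_left_mono mult_left_mono mult_pos_pos) auto
  also have "\<dots> = 8" using nz by (simp add: power2_eq_square)
  finally show ?thesis .
next
  case False
  \<comment> \<open>Away from 0 the small imaginary part forces a large real part, and the two
    fractions are bounded separately, by 5 and 2.\<close>
  have Re: "Re z \<ge> 1/4"
    using cmod_le[of z] z False by linarith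
  have "exp (- Re z) \<le> exp (- (1/4))" using Re by simp
  also have "\<dots> \<le> 4/5"
    using exp_ge_add_one_self[of "1/4"] by (simp add: exp_minus field_simps)
  finally have "1/5 \<le> norm (1 - exp (- z))"
    using norm_triangle_ineq2[of 1 "exp (- z)"] by (simp add: norm_exp_eq_Re)
  moreover have "norm (exp (- (of_real s * z))) \<le> 1"
    using z s by (simp add: norm_exp_eq_Re)
  ultimately have "norm (exp (- (of_real s * z)) / (1 - exp (- z))) \<le> 1 / (1/5)"
    unfolding norm_divide by (intro frac_le) auto
  moreover have "norm (1 / z) \<le> 1 / (1/2)"
    unfolding norm_divide using False by (intro frac_le) auto
  ultimately show ?thesis
    using norm_triangle_ineq4[of "exp (- (of_real s * z)) / (1 - exp (- z))" "1 / z"] by simp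
qed

text \<open>The powers \<open>w ^ j\<close> with \<open>j < k\<close> sum to 0, so \<open>k\<close>
  is the sum of the numbers \<open>1 - w ^ j\<close>, each of norm at most
  \<open>j * norm (1 - w)\<close>. Hence \<open>k\<close> is at most
  \<open>k ^ 2 / 2 * norm (1 - w)\<close>.\<close>

lemma root_of_unity_dist_1_ge:
  fixes w :: complex
  assumes k: "k > 0" and w: "w ^ k = 1" "w \<noteq> 1"
  shows "norm (1 - w) \<ge> 2 / real k"
proof -
  have n1: "norm w = 1" using w(1) k by (metis norm_one norm_power power_eq_1_iff norm_ge_zero neq0_conv)
  have b: "norm (1 - w ^ j) \<le> real j * norm (1 - w)" for j
    using norm_power_diff[of 1 w j] n1 by simp
  have "(\<Sum>j<k. w ^ j) = 0" using w by (simp add: geometric_sum)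
  then have "complex_of_nat k = (\<Sum>j<k. 1 - w ^ j)" by (simp add: sum_subtractf)
  then have "real k = norm (\<Sum>j<k. 1 - w ^ j)" by (metis norm_of_nat)
  also have "\<dots> \<le> (\<Sum>j<k. real j * norm (1 - w))" by (rule sum_norm_le) (use b in auto)
  also have "\<dots> = (\<Sum>j<k. real j) * norm (1 - w)" by (simp add: sum_distrib_right)
  also have "(\<Sum>j<k. real j) = real k * (real k - 1) / 2"
    by (induction k) (auto simp: field_simps)
  also have "real k * (real k - 1) / 2 * norm (1 - w) \<le> real k * real k / 2 * norm (1 - w)"
    by (intro mult_right_mono divide_right_mono mult_left_mono) auto
  finally show ?thesis using k by (simp add: field_simps)
qed

text \<open>Since \<open>l + 1 \<le> 2 * l\<close>, the term \<open>1 / l ^ 2\<close> is dominated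
  by \<open>2 / (l * (l + 1))\<close>, which telescopes.\<close>

lemma has_sum_inverse_squares_tail_le:
  fixes n :: nat assumes "n \<ge> 1"
  shows "(\<lambda>l. 1 / real l ^ 2) summable_on {n..}"
    and "(\<Sum>\<^sub>\<infinity>l\<in>{n..}. 1 / real l ^ 2) \<le> 2 / real n"
proof -
  have "(\<lambda>i. 2 / real (i + n) - 2 / real (Suc i + n)) sums (2 / real (0 + n) - 0)"
    by (rule telescope_sums') real_asymp
  moreover have nn: "2 / real (i + n) - 2 / real (Suc i + n) \<ge> 0" for i
    using assms by (simp add: field_simps)
  ultimately have "((\<lambda>i. 2 / real (i + n) - 2 / real (Suc i + n)) has_sum 2 / real n) UNIV"
    using sums_nonneg_imp_has_sum by fastforce
  moreover have "{n..} = range (\<lambda>i. i + n)"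
    by (auto simp: image_iff intro: le_add_diff_inverse2[symmetric])
  ultimately have *: "((\<lambda>l. 2 / real l - 2 / real (Suc l)) has_sum 2 / real n) {n..}"
    by (simp add: has_sum_reindex o_def inj_on_def)
  have le: "1 / real l ^ 2 \<le> 2 / real l - 2 / real (Suc l)" if "l \<in> {n..}" for l
  proof -
    have "l \<ge> 1" using that assms by auto
    then have "1 / real l ^ 2 \<le> 1 / (real l * ((real l + 1) / 2))"
      by (intro divide_left_mono) (auto simp: power2_eq_square)
    also have "\<dots> = 2 / real l - 2 / real (Suc l)"
      using \<open>l \<ge> 1\<close> by (simp add: divide_simps)
    finally show ?thesis .
  qed
  show s: "(\<lambda>l. 1 / real l ^ 2) summable_on {n..}"
    by (rule summable_on_comparison_test[OF has_sum_imp_summable[OF *]]) (use le in auto)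
  have "(\<Sum>\<^sub>\<infinity>l\<in>{n..}. 1 / real l ^ 2) \<le> (\<Sum>\<^sub>\<infinity>l\<in>{n..}. 2 / real l - 2 / real (Suc l))"
    by (rule infsum_mono[OF s has_sum_imp_summable[OF *]]) (rule le)
  then show "(\<Sum>\<^sub>\<infinity>l\<in>{n..}. 1 / real l ^ 2) \<le> 2 / real n" using infsumI[OF *] by simp
qed

text \<open>The harmonic number minus the logarithm decreases in \<open>n\<close> and equals 1 at
  \<open>n = 1\<close>.\<close>

lemma sum_inverse_le:
  assumes "n \<ge> 1"
  shows "(\<Sum>l=1..n. 1 / real l) \<le> 1 + ln (real n)"
  using euler_mascheroni_sequence_decreasing[of 1 n] assms by (simp add: harm_def inverse_eq_divide)

subsection \<open>The dilogarithm on the unit circle\<close>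

text \<open>The term with \<open>n = 0\<close> is a division by zero and so vanishes; this is the
  usual series over \<open>n \<ge> 1\<close>.\<close>

definition dilog :: "complex \<Rightarrow> complex" where
  "dilog z = (\<Sum>n. z ^ n / of_nat n ^ 2)"

lemma summable_inverse_squares: "summable (\<lambda>n. 1 / real n ^ 2)"
  using inverse_power_summable[of 2, where 'a = real] by (simp add: inverse_eq_divide)

lemma norm_dilog_term_le: "norm z \<le> 1 \<Longrightarrow> norm (z ^ n / of_nat n ^ 2 :: complex) \<le> 1 / real n ^ 2"
  by (simp add: norm_divide norm_power divide_right_mono power_le_one)

lemma dilog_sums: "norm z \<le> 1 \<Longrightarrow> (\<lambda>n. z ^ n / of_nat n ^ 2) sums dilog z"
  unfolding dilog_def
  by (rule summable_sums, rule summable_comparison_test'[OF summable_inverse_squares], rule norm_dilog_term_le)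

text \<open>The convergence is uniform up to the boundary circle; this is what later allows the
  radius to tend to 1.\<close>

lemma continuous_on_dilog: "continuous_on (cball 0 1) dilog"
proof -
  have "uniform_limit (cball 0 1) (\<lambda>n z. \<Sum>i<n. z ^ i / of_nat i ^ 2) dilog sequentially"
    unfolding dilog_def
    by (rule Weierstrass_m_test[OF _ summable_inverse_squares]) (auto intro!: norm_dilog_term_le)
  then show ?thesis
    unfolding divide_inverse
    by (rule uniform_limit_theorem[rotated]) (auto intro!: continuous_intros always_eventually)
qed

text \<open>Termwise differentiation gives the logarithm series divided by \<open>z\<close>. The
  product form includes \<open>z = 0\<close> and is the expression that occurs when differentiating
  along a circle.\<close>

lemma has_field_derivative_dilog:
  assumes "norm z < 1"
  obtains d where "(dilog has_field_derivative d) (at z)" "d * z = - Ln (1 - z)"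
proof
  let ?c = "\<lambda>n. 1 / of_nat n ^ 2 :: complex"
  let ?d = "\<Sum>n. diffs ?c n * z ^ n"
  have sm: "summable (\<lambda>n. ?c n * 1 ^ n)"
    using dilog_sums[of 1] by (simp add: sums_iff)
  have "((\<lambda>z. \<Sum>n. ?c n * z ^ n) has_field_derivative ?d) (at z)"
    using termdiffs_strong[OF sm, of z] assms by simp
  then show "(dilog has_field_derivative ?d) (at z)"
    by (simp add: dilog_def[abs_def])
  have "(\<lambda>l. z ^ l / of_nat l) sums - Ln (1 - z)"
    using sums_minus[OF Ln_series'[of "- z"]] assms by simp
  then have "(\<lambda>n. z ^ Suc n / of_nat (Suc n)) sums - Ln (1 - z)"
    by (subst sums_Suc_iff) simp
  moreover have "summable (\<lambda>n. diffs ?c n * z ^ n)"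
  proof (rule termdiff_converges)
    show "norm z < 1" by (rule assms)
    fix x :: complex assume "norm x < 1"
    then show "summable (\<lambda>n. ?c n * x ^ n)" using dilog_sums[of x] by (simp add: sums_iff)
  qed
  then have "(\<lambda>n. diffs ?c n * z ^ n * z) sums (?d * z)"
    by (intro sums_mult2 summable_sums)
  moreover have "diffs ?c n * z ^ n * z = z ^ Suc n / of_nat (Suc n)" for n
    by (simp add: diffs_def power2_eq_square field_simps del: of_nat_Suc)
  ultimately show "?d * z = - Ln (1 - z)" by (simp add: sums_iff)
qed

text \<open>Half-angle formulas give
  \<open>1 - cis t = 2 * sin (t / 2) * cis ((t - pi) / 2)\<close>. The sine is positive and the
  angle lies strictly between \<open>- pi / 2\<close> and \<open>pi / 2\<close>, so the principal
  logarithm returns it unchanged.\<close>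

lemma Ln_one_minus_cis:
  assumes "0 < t" "t < 2 * pi"
  shows "Im (Ln (1 - cis t)) = (t - pi) / 2"
proof -
  have s: "sin (t / 2) > 0" using assms by (intro sin_gt_zero) auto
  have "cis ((t - pi) / 2) = cis (t / 2) * - \<i>"
    by (simp add: diff_divide_distrib cis_divide[symmetric])
  then have "1 - cis t = of_real (2 * sin (t / 2)) * cis ((t - pi) / 2)"
    using cos_double_sin[of "t/2"] sin_double[of "t/2"]
    by (simp add: complex_eq_iff power2_eq_square)
  also have "\<dots> = exp (Complex (ln (2 * sin (t / 2))) ((t - pi) / 2))"
    using s by (simp add: exp_eq_polar)
  finally show ?thesis
    using Ln_exp[of "Complex (ln (2 * sin (t / 2))) ((t - pi) / 2)"] assms by simp
qed

text \<open>
  The differentiated series does not converge absolutely on the unit circle, so the derivative is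
  computed at radius \<open>r < 1\<close>, and \<open>r\<close> then tends to 1.
\<close>

lemma Re_dilog_cis_diff:
  assumes uv: "0 < u" "u \<le> v" "v < 2 * pi"
  shows "Re (dilog (cis v)) - Re (dilog (cis u)) = (v\<^sup>2 / 4 - pi * v / 2) - (u\<^sup>2 / 4 - pi * u / 2)"
proof -
  \<comment> \<open>\<open>D r\<close> is the deviation from the expected quadratic on the circle of
    radius \<open>r\<close>; the claim is that \<open>D 1\<close> takes equal values at
    \<open>u\<close> and \<open>v\<close>.\<close>
  define D where "D = (\<lambda>r x. Re (dilog (of_real r * cis x)) - (x\<^sup>2 / 4 - pi * x / 2))"
  define g where "g = (\<lambda>(r, x). Ln (1 - of_real r * cis x))"
  \<comment> \<open>The argument of \<open>Ln\<close> stays off the branch cut because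
    \<open>cos x < 1\<close> on \<open>{u..v}\<close>. Compactness then makes the logarithm
    uniformly continuous up to radius 1.\<close>
  have in_slit: "1 - of_real r * cis x \<notin> \<real>\<^sub>\<le>\<^sub>0" if "r \<in> {0..1}" "x \<in> {u..v}" for r x
  proof
    assume "1 - of_real r * cis x \<in> \<real>\<^sub>\<le>\<^sub>0"
    then have "r * cos x \<ge> 1" by (auto simp: complex_nonpos_Reals_iff)
    moreover have "cos x < 1"
      using cos_double_sin[of "x/2"] sin_gt_zero[of "x/2"] that uv by simp
    moreover have "r * cos x \<le> max 0 (cos x)"
      using that mult_right_mono[of r 1 "cos x"] mult_nonneg_nonpos[of r "cos x"]
      by (cases "cos x \<le> 0") auto
    ultimately show False by simp
  qed
  have uc: "uniformly_continuous_on ({0..1} \<times> {u..v}) g"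
  proof (rule compact_uniformly_continuous)
    show "continuous_on ({0..1} \<times> {u..v}) g"
      unfolding g_def case_prod_unfold by (intro continuous_intros) (use in_slit in auto)
  qed (intro compact_Times compact_Icc)
  have deriv: "((\<lambda>x. D r x) has_field_derivative (Im (Ln (1 - of_real r * cis x)) - (x - pi) / 2)) (at x)"
    if "r \<in> {0..<1}" for r x
  proof -
    have "norm (of_real r * cis x) < 1" using that by (simp add: norm_mult)
    then obtain d where d: "(dilog has_field_derivative d) (at (of_real r * cis x))"
      "d * (of_real r * cis x) = - Ln (1 - of_real r * cis x)"
      by (rule has_field_derivative_dilog)
    have "((\<lambda>x. of_real r * cis x) has_vector_derivative (of_real r * (\<i> * cis x))) (at x)"
      by (auto intro!: derivative_eq_intros has_vector_derivative_mult_right simp: has_vector_derivative_def)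
    from field_vector_diff_chain_at[OF this d(1)]
    have "((\<lambda>x. dilog (of_real r * cis x)) has_vector_derivative (of_real r * (\<i> * cis x) * d)) (at x)"
      by (simp add: o_def)
    also have "of_real r * (\<i> * cis x) * d = \<i> * (d * (of_real r * cis x))" by (simp add: mult_ac)
    also have "\<dots> = - \<i> * Ln (1 - of_real r * cis x)" by (simp add: d(2))
    finally have "((\<lambda>x. Re (dilog (of_real r * cis x))) has_real_derivative
        (Re (- \<i> * Ln (1 - of_real r * cis x)))) (at x)"
      unfolding has_real_derivative_iff_has_vector_derivative
      by (rule bounded_linear.has_vector_derivative[OF bounded_linear_Re])
    moreover have "((\<lambda>x. x\<^sup>2 / 4 - pi * x / 2) has_real_derivative (x - pi) / 2) (at x)"
      by (auto intro!: derivative_eq_intros simp: field_simps)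
    ultimately show ?thesis
      unfolding D_def by (rule DERIV_cong[OF DERIV_diff]) simp
  qed
  have bound: "\<bar>D 1 v - D 1 u\<bar> \<le> e * (v - u)" if e: "e > 0" for e
  proof -
    obtain d where d: "d > 0" "\<forall>p \<in> {0..1} \<times> {u..v}. \<forall>p' \<in> {0..1} \<times> {u..v}.
        dist p' p < d \<longrightarrow> dist (g p') (g p) < e"
      using uc e unfolding uniformly_continuous_on_def by blast
    have le: "\<bar>D r v - D r u\<bar> \<le> e * (v - u)" if r: "r \<in> {max 0 (1 - d)<..<1}" for r
    proof -
      have "norm (D r v - D r u) \<le> e * norm (v - u)"
      proof (rule field_differentiable_bound[where S = "{u..v}"])
        fix x assume x: "x \<in> {u..v}"
        show "(D r has_field_derivative (Im (Ln (1 - of_real r * cis x)) - (x - pi) / 2)) (at x within {u..v})"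
          using r by (intro DERIV_subset[OF deriv]) auto
        \<comment> \<open>At radius 1 the expression for the derivative vanishes, by the formula for
          \<open>Ln (1 - cis x)\<close>; uniform continuity therefore makes the derivative of
          \<open>D r\<close> at most \<open>e\<close> for all \<open>x\<close> at once.\<close>
        have "dist (g (r, x)) (g (1, x)) < e"
          using r x by (intro d(2)[rule_format]) (auto simp: dist_Pair_Pair dist_real_def)
        then have "\<bar>Im (g (r, x)) - Im (g (1, x))\<bar> < e"
          unfolding dist_norm by (metis abs_Im_le_cmod le_less_trans minus_complex.simps(2))
        moreover have "Im (g (1, x)) = (x - pi) / 2"
          using Ln_one_minus_cis[of x] x uv by (simp add: g_def)
        ultimately have "\<bar>Im (g (r, x)) - (x - pi) / 2\<bar> \<le> e" by linarith
        then show "norm (Im (Ln (1 - of_real r * cis x)) - (x - pi) / 2) \<le> e" by (simp add: g_def)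
      qed (use uv in auto)
      then show ?thesis using uv by simp
    qed
    have lim: "((\<lambda>r. D r x) \<longlongrightarrow> D 1 x) (at_left 1)" for x
    proof -
      have "continuous_on {0..1} (\<lambda>r. D r x)" unfolding D_def
        by (intro continuous_intros continuous_on_compose2[OF continuous_on_dilog]) (auto simp: norm_mult)
      then have "((\<lambda>r. D r x) \<longlongrightarrow> D 1 x) (at 1 within {0..1})"
        by (auto simp: continuous_on_def)
      then show ?thesis by (simp add: at_within_Icc_at_left)
    qed
    show ?thesis
    proof (rule tendsto_upperbound)
      show "((\<lambda>r. \<bar>D r v - D r u\<bar>) \<longlongrightarrow> \<bar>D 1 v - D 1 u\<bar>) (at_left 1)"
        by (intro tendsto_intros lim)
      show "\<forall>\<^sub>F r in at_left 1. \<bar>D r v - D r u\<bar> \<le> e * (v - u)"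
        using eventually_at_left_real[of "max 0 (1 - d)" 1] d(1) by (auto elim!: eventually_mono intro: le)
    qed simp
  qed
  have "\<bar>D 1 v - D 1 u\<bar> \<le> 0"
  proof (rule field_le_epsilon)
    fix e :: real assume "e > 0"
    \<comment> \<open>The summand 1 in the divisor covers the case \<open>u = v\<close>.\<close>
    then have "\<bar>D 1 v - D 1 u\<bar> \<le> e / (v - u + 1) * (v - u)"
      using uv by (intro bound) auto
    also have "\<dots> \<le> e" using uv \<open>e > 0\<close> by (simp add: field_simps)
    finally show "\<bar>D 1 v - D 1 u\<bar> \<le> 0 + e" by simp
  qed
  then show ?thesis by (simp add: D_def)
qed

text \<open>The difference formula determines the value up to a constant, which continuity at
  \<open>x = 0\<close> and the Basel sum fix. The result is \<open>pi ^ 2\<close> times the second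
  Bernoulli polynomial at \<open>x / (2 * pi)\<close>.\<close>

lemma Re_dilog_cis:
  assumes "0 < x" "x \<le> 2 * pi"
  shows "Re (dilog (cis x)) = x\<^sup>2 / 4 - pi * x / 2 + pi\<^sup>2 / 6"
proof -
  have "(\<lambda>n. 1 / of_nat (Suc n) ^ 2) sums dilog 1"
    using dilog_sums[of 1] by (subst sums_Suc_iff) simp
  moreover have "(\<lambda>n. complex_of_real (1 / (real n + 1)\<^sup>2)) sums of_real (pi\<^sup>2 / 6)"
    by (subst sums_of_real_iff) (use inverse_squares_sums in \<open>simp add: add.commute\<close>)
  then have "(\<lambda>n. 1 / of_nat (Suc n) ^ 2) sums complex_of_real (pi\<^sup>2 / 6)"
    by (simp add: add.commute)
  ultimately have "dilog 1 = of_real (pi\<^sup>2 / 6)"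
    by (rule sums_unique2)
  then have one: "Re (dilog 1) = pi\<^sup>2 / 6"
    by (simp only: Re_complex_of_real)
  show ?thesis
  proof (cases "x = 2 * pi")
    case True
    then show ?thesis using one by (simp add: power2_eq_square)
  next
    case False
    define G where "G = (\<lambda>x. Re (dilog (cis x)) - (x\<^sup>2 / 4 - pi * x / 2))"
    have "continuous_on UNIV G" unfolding G_def
      by (intro continuous_intros continuous_on_compose2[OF continuous_on_dilog]) auto
    then have "(G \<longlongrightarrow> G 0) (at_right 0)"
      by (metis continuous_on_def UNIV_I tendsto_within_subset subset_UNIV)
    \<comment> \<open>\<open>G\<close> is constant to the right of 0, so its limit there is both
      \<open>G 0\<close> and \<open>G x\<close>.\<close>
    moreover have "\<forall>\<^sub>F u in at_right 0. G u = G x"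
    proof (rule eventually_at_rightI)
      show "0 < x" by fact
      fix u assume "u \<in> {0<..<x}"
      then show "G u = G x"
        using Re_dilog_cis_diff[of u x] assms False by (simp add: G_def)
    qed
    then have "(G \<longlongrightarrow> G x) (at_right 0)" by (rule tendsto_eventually)
    ultimately have "G 0 = G x" by (rule tendsto_unique[rotated]) simp
    then have "Re (dilog 1) = Re (dilog (cis x)) - (x\<^sup>2 / 4 - pi * x / 2)" by (simp add: G_def)
    then show ?thesis using one by linarith
  qed
qed

lemma dilog_has_sum:
  assumes "norm z \<le> 1"
  shows "((\<lambda>n. z ^ n / of_nat n ^ 2) has_sum dilog z) {1..}"
proof -
  have "((\<lambda>n. z ^ n / of_nat n ^ 2) has_sum dilog z) UNIV"
    by (intro norm_summable_imp_has_sum dilog_sums assms summable_comparison_test'[OF summable_inverse_squares])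
       (auto intro!: norm_dilog_term_le assms)
  then show ?thesis
    by (rule has_sum_cong_neutral[THEN iffD1, rotated -1]) (auto simp: not_le)
qed

lemma dilog_cnj: "norm z \<le> 1 \<Longrightarrow> dilog (cnj z) = cnj (dilog z)"
  using sums_cnj[THEN iffD2, OF dilog_sums[of z]] dilog_sums[of "cnj z"]
  by (simp add: sums_iff)

subsection \<open>Approximation of a single series\<close>

text \<open>Absolute summability permits summing over \<open>m\<close> first, for fixed
  \<open>l\<close>; this is a geometric series with ratio \<open>q ^ (l * M)\<close> that starts at
  \<open>m = 2\<close>.\<close>

lemma Psi_has_sum:
  fixes q :: complex
  assumes q: "norm q < 1" and M: "0 < M"
  shows "((\<lambda>l. q ^ (l * (2 * M + c)) / (1 - q ^ (l * M)) / of_nat l) has_sum Psi c M q) {1..}"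
proof -
  have "(\<lambda>x. case x of (m, l) \<Rightarrow> q ^ (l * (m * M + c)) / of_nat l) summable_on {2..} \<times> {1..}"
    by (rule abs_summable_summable[OF abs_summable_Psi[OF q M]])
  from infsum_Sigma_banach[OF this] has_sum_infsum[OF this]
  have sum: "((\<lambda>(m, l). q ^ (l * (m * M + c)) / of_nat l) has_sum Psi c M q) ({2..} \<times> {1..})"
    by (simp add: Psi_def case_prod_unfold)
  show ?thesis
  proof (rule has_sum_SigmaD)
    show "((\<lambda>(l, m). q ^ (l * (m * M + c)) / of_nat l) has_sum Psi c M q) ({1..} \<times> {2..})"
      using sum by (subst (asm) has_sum_swap) (simp add: case_prod_unfold)
  next
    fix l :: nat assume l: "l \<in> {1..}"
    have lt: "norm (q ^ (l * M)) < 1"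
      using q l M by (simp add: norm_power power_less_one_iff)
    have "((\<lambda>n. (q ^ (l * M)) ^ n) has_sum (1 / (1 - q ^ (l * M)))) UNIV"
    proof (intro norm_summable_imp_has_sum geometric_sums lt)
      show "summable (\<lambda>n. norm ((q ^ (l * M)) ^ n))"
        unfolding norm_power[of "q ^ (l * M)"] using lt by (intro summable_geometric) simp
    qed
    then have "((\<lambda>n. q ^ (l * (2 * M + c)) / of_nat l * (q ^ (l * M)) ^ n) has_sum 
        (q ^ (l * (2 * M + c)) / of_nat l * (1 / (1 - q ^ (l * M))))) UNIV" (is "(_ has_sum ?S) UNIV")
      by (rule has_sum_cmult_right)
    also have "(\<lambda>n. q ^ (l * (2 * M + c)) / of_nat l * (q ^ (l * M)) ^ n) =
        (\<lambda>m. q ^ (l * (m * M + c)) / of_nat l) \<circ> (\<lambda>i. i + 2)"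
    proof
      fix n
      have "l * ((n + 2) * M + c) = l * (2 * M + c) + l * M * n" by (simp add: algebra_simps)
      then have "q ^ (l * ((n + 2) * M + c)) = q ^ (l * (2 * M + c)) * (q ^ (l * M)) ^ n"
        by (simp only: power_add power_mult[of q "l * M" n])
      then show "q ^ (l * (2 * M + c)) / of_nat l * (q ^ (l * M)) ^ n =
          ((\<lambda>m. q ^ (l * (m * M + c)) / of_nat l) \<circ> (\<lambda>i. i + 2)) n"
        by simp
    qed
    also have "(\<dots> has_sum ?S) UNIV \<longleftrightarrow>
        ((\<lambda>m. q ^ (l * (m * M + c)) / of_nat l) has_sum ?S) (range (\<lambda>i. i + 2))"
      by (rule has_sum_reindex[symmetric]) (auto simp: inj_on_def)
    also have "range (\<lambda>i. i + 2) = {2::nat..}"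
    proof (intro set_eqI iffI)
      fix m :: nat
      assume "m \<in> {2..}"
      then show "m \<in> range (\<lambda>i. i + 2)" by (intro range_eqI[of _ _ "m - 2"]) simp
    qed auto
    finally show "((\<lambda>m. case (l, m) of (l, m) \<Rightarrow> q ^ (l * (m * M + c)) / of_nat l) has_sum
        q ^ (l * (2 * M + c)) / (1 - q ^ (l * M)) / of_nat l) {2..}" by (simp add: mult_ac)
  qed
qed

lemma cis_2pi_eq_1_iff: "cis (2 * pi * y) = 1 \<longleftrightarrow> y \<in> \<int>"
proof
  assume "cis (2 * pi * y) = 1"
  then have "exp (\<i> * of_real (2 * pi * y)) = 1" by (simp add: cis_conv_exp)
  then obtain n :: int where "2 * pi * y = of_int (2 * n) * pi" unfolding exp_eq_1 by auto
  then show "y \<in> \<int>" by simp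
qed (rule cis_multiple_2pi)

text \<open>This separates the decaying factor in \<tau> from a phase that depends on
  \<open>n\<close> only modulo \<open>k\<close>.\<close>

lemma q_power_eq:
  assumes "q = exp (- \<tau> + 2 * complex_of_real pi * \<i> * of_int h / of_nat k)"
  shows "q ^ n = exp (- (of_nat n * \<tau>)) * cis (2 * pi * (of_int h * real n / real k))"
proof -
  have "q ^ n = exp (of_nat n * (- \<tau> + 2 * complex_of_real pi * \<i> * of_int h / of_nat k))"
    unfolding assms by (rule exp_of_nat_mult[symmetric])
  also have "of_nat n * (- \<tau> + 2 * complex_of_real pi * \<i> * of_int h / of_nat k) =
      - (of_nat n * \<tau>) + \<i> * of_real (2 * pi * (of_int h * real n / real k))"
    by (simp add: algebra_simps)
  finally show ?thesis by (simp only: exp_add cis_conv_exp)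
qed

text \<open>The sum \<open>S\<close> of the main terms is left abstract, so that the termwise
  comparison is independent of its evaluation by the dilogarithm. The first error term comes from
  \<open>l \<le> L\<close>, the second from the tail.\<close>

lemma Psi_approx:
  fixes X Y :: real and \<tau> q :: complex and h :: int and k M c N :: nat
  assumes X: "X > 0" and k: "k > 0" "k \<le> N" and M: "M > 0" and c: "c \<le> M"
    and hk: "coprime h (int k)"
    and Y: "\<bar>Y\<bar> \<le> 1 / (real k * real N)" and N: "real N ^ 2 \<le> 2 * pi * X"
    and \<tau>: "Re \<tau> = 1 / X" "Im \<tau> = 2 * pi * Y"
    and q: "q = exp (- \<tau> + 2 * complex_of_real pi * \<i> * of_int h / of_nat k)"
    and S: "((\<lambda>l. if k dvd l * M then cis (2 * pi * (of_int h * real (l * c) / real k)) /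
      (of_nat l ^ 2 * of_nat M * \<tau>) else 0)
        has_sum S) {1..}"
  shows "norm (Psi c M q - S) \<le> 8 * real N * (1 + ln (real N)) + 128 * real M * X / real N"
proof -
  define T where "T = (\<lambda>l. q ^ (l * (2 * M + c)) / (1 - q ^ (l * M)) / of_nat l)"
  define m where "m = (\<lambda>l. if k dvd l * M then cis (2 * pi * (of_int h * real (l * c) / real k)) /
      (of_nat l ^ 2 * of_nat M * \<tau>) else 0)"
  \<comment> \<open>For \<open>l \<le> L\<close> this gives \<open>l * M \<le> N / 32\<close>. With
    \<open>pi < 4\<close> and the bounds on \<open>X\<close> and \<open>Y\<close>, both parts of
    \<open>l * M * \<tau>\<close> are then at most \<open>1 / (4 * k)\<close> in absolute
    value.\<close>
  define L where "L = N div (32 * M)"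
  have N0: "N > 0" using k by simp
  have nq: "norm (q ^ n) = exp (- (real n / X))" for n
    by (simp add: q_power_eq[OF q] norm_mult \<tau> del: of_nat_mult)
  have q1: "norm q < 1" using nq[of 1] X by simp
  have \<tau>_ge: "norm \<tau> \<ge> 1 / X" using complex_Re_le_cmod[of \<tau>] \<tau> by simp
  \<comment> \<open>Ignoring the phase, the quotient is at most
    \<open>exp (- x) / (1 - exp (- x))\<close>, hence at most \<open>1 / x\<close>. The main term
    has the same size because \<open>norm \<tau> \<ge> 1 / X\<close>.\<close>
  have far: "norm (T l - m l) \<le> 2 * X / real l ^ 2" if l: "l \<ge> 1" for l
  proof -
    define x where "x = real (l * M) / X"
    have x: "x > 0" using l M X by (simp add: x_def)
    have "norm (q ^ (l * (2 * M + c))) \<le> exp (- x)"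
      unfolding nq x_def using X by (simp add: divide_right_mono algebra_simps)
    moreover have "1 - exp (- x) \<le> norm (1 - q ^ (l * M))"
      using norm_triangle_ineq2[of 1 "q ^ (l * M)"] unfolding nq x_def by simp
    ultimately have "norm (q ^ (l * (2 * M + c)) / (1 - q ^ (l * M))) \<le> exp (- x) / (1 - exp (- x))"
      unfolding norm_divide using x by (intro frac_le) auto
    also have "\<dots> \<le> 1 / x"
      using x exp_ge_add_one_self[of x] by (simp add: exp_minus field_simps)
    also have "\<dots> \<le> X / real l"
      unfolding x_def using X M l by (simp add: field_simps)
    finally have "norm (T l) \<le> X / real l / real l"
      unfolding T_def norm_divide[of _ "of_nat l"] norm_of_nat by (rule divide_right_mono) simp
    moreover have "norm (m l) \<le> X / real l / real l"
    proof -
      have "1 / X \<le> real M * norm \<tau>"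
        using \<tau>_ge M mult_right_mono[of 1 "real M" "norm \<tau>"] by simp
      then have "1 / (real l ^ 2 * (real M * norm \<tau>)) \<le> 1 / (real l ^ 2 * (1 / X))"
        using l X M \<tau>_ge
        by (intro divide_left_mono mult_left_mono mult_pos_pos) (auto intro: less_le_trans[of 0 "1 / X"])
      then show ?thesis
        using X by (simp add: m_def norm_divide norm_mult norm_power mult.assoc power2_eq_square)
    qed
    ultimately show ?thesis
      using norm_triangle_ineq4[of "T l" "m l"] by (simp add: power2_eq_square)
  qed
  have near: "norm (T l - m l) \<le> 8 * real k / real l" if l: "l \<in> {1..L}" for l
  proof -
    define z where "z = of_nat (l * M) * \<tau>"
    define s where "s = real (2 * M + c) / real M"
    have s: "0 \<le> s" "s \<le> 3" using M c by (auto simp: s_def field_simps)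
    have "l * (32 * M) \<le> N" 
      using l M by (simp add: L_def less_eq_div_iff_mult_less_eq)
    then have "real (l * (32 * M)) \<le> real N" by linarith
    then have lM: "real (l * M) \<le> real N / 32" by simp
    have Rez: "Re z > 0" "Re z \<le> 1 / 4 / real k"
    proof -
      show "Re z > 0" using l M X by (simp add: z_def \<tau>)
      have "Re z \<le> real N / 32 * (2 * pi / real N ^ 2)"
      proof -
        have "1 / X \<le> 2 * pi / real N ^ 2" using N X N0 by (simp add: field_simps)
        then have "real (l * M) * (1 / X) \<le> real N / 32 * (2 * pi / real N ^ 2)"
          by (intro mult_mono lM) (use X in auto)
        then show ?thesis by (simp add: z_def \<tau>)
      qed
      also have "\<dots> = pi / 16 / real N" by (simp add: power2_eq_square)
      also have "\<dots> \<le> 4 / 16 / real k"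
        using k pi_less_4 by (intro frac_le divide_right_mono) auto
      finally show "Re z \<le> 1 / 4 / real k" by simp
    qed
    have Imz: "\<bar>Im z\<bar> \<le> 1 / 4 / real k"
    proof -
      have "\<bar>Im z\<bar> = real (l * M) * (2 * pi * \<bar>Y\<bar>)" by (simp add: z_def \<tau> abs_mult)
      also have "\<dots> \<le> real N / 32 * (2 * pi * (1 / (real k * real N)))"
        by (intro mult_mono lM Y) auto
      also have "\<dots> = pi / 16 / real k" using N0 by simp
      also have "\<dots> \<le> 4 / 16 / real k"
        using k pi_less_4 by (intro divide_right_mono) auto
      finally show ?thesis by simp
    qed
    let ?w = "cis (2 * pi * (of_int h * real (l * M) / real k))"
    have qlM: "q ^ (l * M) = exp (- z) * ?w"
      unfolding q_power_eq[OF q] z_def ..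
    have norm_num: "norm (q ^ (l * (2 * M + c))) \<le> 1"
      unfolding nq using X by simp
    show ?thesis
    \<comment> \<open>In the resonant case \<open>q ^ (l * M)\<close> has trivial phase and the
      numerator keeps only the phase of \<open>l * c\<close>. The resulting bound
      \<open>8 / l\<close> is weakened to \<open>8 * k / l\<close>, so that both cases share one
      majorant.\<close>
    proof (cases "k dvd l * M")
      case True
      then obtain j where "l * M = k * j" by (elim dvdE)
      then have "real (l * M) / real k = real j" using k by (simp only: of_nat_mult) simp
      then have w: "real (l * M) / real k \<in> \<int>" by (simp only: Ints_of_nat)
      have n: "real (l * (2 * M + c)) = 2 * real (l * M) + real (l * c)"
        by (simp add: algebra_simps)
      have "2 * pi * (of_int h * real (l * (2 * M + c)) / real k) =
         2 * pi * (2 * of_int h * (real (l * M) / real k)) + 2 * pi * (of_int h * real (l * c) / real k)"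
        unfolding n by (simp add: algebra_simps add_divide_distrib)
      moreover have "cis (2 * pi * (2 * of_int h * (real (l * M) / real k))) = 1"
        by (intro cis_multiple_2pi Ints_mult w) auto
      ultimately have c1: "cis (2 * pi * (of_int h * real (l * (2 * M + c)) / real k)) = 
          cis (2 * pi * (of_int h * real (l * c) / real k))" (is "_ = ?v")
        by (simp only: cis_mult[symmetric] mult_1)
      have w1: "?w = 1" 
        using Ints_mult[OF _ w, of "of_int h"] by (intro cis_multiple_2pi) simp
      have "of_nat (l * (2 * M + c)) * \<tau> = of_real s * z"
        using M by (simp add: s_def z_def field_simps)
      then have "T l = ?v / of_nat l * (exp (- (of_real s * z)) / (1 - exp (- z)))"
        unfolding T_def qlM w1 q_power_eq[OF q, of "l * (2 * M + c)"] c1 by (simp add: mult_ac)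
      moreover have "m l = ?v / of_nat l * (1 / z)"
        using True by (simp add: m_def z_def power2_eq_square)
      ultimately have "T l - m l = ?v / of_nat l * (exp (- (of_real s * z)) / (1 - exp (- z)) - 1 / z)"
        by (simp only: right_diff_distrib)
      then have "norm (T l - m l) = 1 / real l * norm (exp (- (of_real s * z)) / (1 - exp (- z)) - 1 / z)"
        by (simp add: norm_mult norm_divide)
      also have "\<dots> \<le> 1 / real l * 8"
      proof (intro mult_left_mono exp_quotient_minus_inverse_bound Rez s)
        have "1 / 4 / real k \<le> 1 / 4" using k by (simp add: field_simps)
        then show "\<bar>Im z\<bar> \<le> 1 / 4" using Imz by linarith
      qed simp
      also have "\<dots> \<le> 8 * real k / real l" using k by (simp add: divide_right_mono)
      finally show ?thesis .
    next
      case False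
      \<comment> \<open>By coprimality of \<open>h\<close> and \<open>k\<close> the phase is a
        nontrivial \<open>k\<close>-th root of unity, at distance at least \<open>2 / k\<close> from
        1. The factor \<open>exp (- z)\<close> moves it by at most \<open>1 / k\<close>, so the
        denominator stays at least \<open>1 / k\<close>.\<close>
      have "?w ^ k = cis (2 * pi * (of_int h * real (l * M)))"
        using k by (simp add: Complex.DeMoivre)
      also have "\<dots> = 1" by (intro cis_multiple_2pi Ints_mult) auto
      finally have wk: "?w ^ k = 1" .
      have w1: "?w \<noteq> 1"
      proof
        assume "?w = 1"
        then have "of_int h * real (l * M) / real k \<in> \<int>" by (simp only: cis_2pi_eq_1_iff)
        then obtain n :: int where "of_int h * real (l * M) / real k = of_int n" by (elim Ints_cases)
        then have "of_int h * real (l * M) = of_int n * real k" using k by (simp add: field_simps)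
        then have "real_of_int (h * int (l * M)) = real_of_int (n * int k)" by simp
        then have "h * int (l * M) = n * int k" by (simp only: of_int_eq_iff)
        then have "int k dvd h * int (l * M)" by simp
        then have "int k dvd int (l * M)" using hk by (simp add: coprime_dvd_mult_right_iff coprime_commute)
        then show False using False by (simp only: int_dvd_int_iff)
      qed
      have "norm z \<le> 1 / 4 / real k + 1 / 4 / real k"
        using cmod_le[of z] Rez Imz by linarith
      also have "\<dots> \<le> 1 / real k" using k by (simp add: field_simps)
      finally have "norm (?w * (1 - exp (- z))) \<le> 1 / real k"
        using norm_exp_minus_diff_le[of z] Rez by (simp add: norm_mult)
      moreover have "norm (1 - ?w) \<ge> 2 / real k"
        by (rule root_of_unity_dist_1_ge[OF k(1) wk w1])
      moreover have "norm (1 - ?w) \<le> norm (1 - q ^ (l * M)) + norm (?w * (1 - exp (- z)))"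
        using norm_triangle_ineq4[of "1 - q ^ (l * M)" "?w * (1 - exp (- z))"]
        unfolding qlM by (simp add: algebra_simps)
      ultimately have "norm (1 - q ^ (l * M)) \<ge> 1 / real k" by (simp add: field_simps)
      then have "norm (q ^ (l * (2 * M + c)) / (1 - q ^ (l * M))) \<le> 1 / (1 / real k)"
        unfolding norm_divide using norm_num k by (intro frac_le) auto
      then have "norm (T l) \<le> real k / real l"
        unfolding T_def norm_divide[of _ "of_nat l"] by (simp add: divide_right_mono)
      also have "\<dots> \<le> 8 * real k / real l" by (simp add: divide_right_mono)
      finally show ?thesis using False by (simp add: m_def)
    qed
  qed
  define \<beta> where "\<beta> = (\<lambda>l. if l \<le> L then 8 * real k / real l else 2 * X / real l ^ 2)"
  define B where "B = (\<Sum>l=1..L. 8 * real k / real l) + 2 * X * (\<Sum>\<^sub>\<infinity>l\<in>{Suc L..}. 1 / real l ^ 2)"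
  have "(\<beta> has_sum (\<Sum>l=1..L. 8 * real k / real l)) {1..L}"
    by (rule has_sum_finiteI) (auto simp: \<beta>_def)
  moreover have "((\<lambda>l. 2 * X * (1 / real l ^ 2)) has_sum
      2 * X * (\<Sum>\<^sub>\<infinity>l\<in>{Suc L..}. 1 / real l ^ 2)) {Suc L..}"
    by (intro has_sum_cmult_right has_sum_infsum has_sum_inverse_squares_tail_le) simp
  then have "(\<beta> has_sum 2 * X * (\<Sum>\<^sub>\<infinity>l\<in>{Suc L..}. 1 / real l ^ 2)) {Suc L..}"
    by (rule has_sum_cong[THEN iffD1, rotated]) (auto simp: \<beta>_def)
  ultimately have "(\<beta> has_sum B) ({1..L} \<union> {Suc L..})"
    unfolding B_def by (rule has_sum_Un_disjoint) auto
  also have "{1..L} \<union> {Suc L..} = {1..}" by auto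
  finally have \<beta>: "(\<beta> has_sum B) {1..}" .
  have "((\<lambda>l. - m l) has_sum - S) {1..}"
    unfolding has_sum_uminus minus_minus m_def by (rule S)
  from has_sum_add[OF Psi_has_sum[OF q1 M, of c] this]
  have "((\<lambda>l. T l - m l) has_sum (Psi c M q - S)) {1..}"
    by (simp add: T_def)
  then have le_B: "norm (Psi c M q - S) \<le> B"
    by (rule norm_infsum_le[OF _ \<beta>]) (use near far in \<open>auto simp: \<beta>_def\<close>)
  have head: "(\<Sum>l=1..L. 8 * real k / real l) \<le> 8 * real N * (1 + ln (real N))"
  \<comment> \<open>The harmonic estimate requires a nonempty range; for \<open>L = 0\<close> the
    sum is empty.\<close>
  proof (cases "L \<ge> 1")
    case True
    have "(\<Sum>l=1..L. 8 * real k / real l) = 8 * real k * (\<Sum>l=1..L. 1 / real l)"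
      by (simp add: sum_distrib_left)
    also have "\<dots> \<le> 8 * real N * (1 + ln (real N))"
    proof (intro mult_mono)
      have "L \<le> N" by (simp add: L_def)
      then show "(\<Sum>l=1..L. 1 / real l) \<le> 1 + ln (real N)"
        using sum_inverse_le[OF True] True ln_mono[of "real L" "real N"] by linarith
    qed (use k in \<open>auto intro!: sum_nonneg\<close>)
    finally show ?thesis .
  qed (use N0 in \<open>auto intro!: mult_nonneg_nonneg add_nonneg_nonneg\<close>)
  have "B \<le> 8 * real N * (1 + ln (real N)) + 128 * real M * X / real N"
  proof -
    \<comment> \<open>Rounding in the definition of \<open>L\<close> costs less than one step, so
      the tail from \<open>Suc L\<close> on is at most \<open>64 * M / N\<close>.\<close>
    have "N < Suc L * (32 * M)"
      unfolding L_def using M by (simp add: dividend_less_div_times)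
    then have "real N \<le> real (Suc L * (32 * M))" by linarith
    then have "2 / real (Suc L) \<le> 64 * real M / real N"
      using N0 by (simp add: field_simps)
    then have "(\<Sum>\<^sub>\<infinity>l\<in>{Suc L..}. 1 / real l ^ 2) \<le> 64 * real M / real N"
      using has_sum_inverse_squares_tail_le(2)[of "Suc L"] by simp
    then have "2 * X * (\<Sum>\<^sub>\<infinity>l\<in>{Suc L..}. 1 / real l ^ 2) \<le> 2 * X * (64 * real M / real N)"
      using X by (intro mult_left_mono) auto
    also have "\<dots> = 128 * real M * X / real N" by simp
    finally show ?thesis unfolding B_def by (intro add_mono head)
  qed
  with le_B show ?thesis by linarith
qed

subsection \<open>The main term\<close>

text \<open>With \<open>g = gcd k M\<close> and \<open>K = k div g\<close>, the resonant
  \<open>l\<close> are exactly the multiples of \<open>K\<close>, because \<open>K\<close> is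
  coprime to \<open>M div g\<close>. Substituting \<open>l = K * j\<close> leaves a dilogarithm at a
  \<open>g\<close>-th root of unity.\<close>

lemma resonant_terms_has_sum:
  fixes h :: int and k M c :: nat and \<tau> :: complex
  assumes k: "k > 0"
  shows "((\<lambda>l. if k dvd l * M then cis (2 * pi * (of_int h * real (l * c) / real k)) /
      (of_nat l ^ 2 * of_nat M * \<tau>) else 0)
    has_sum (of_nat (gcd k M) ^ 2 / (of_nat k ^ 2 * of_nat M * \<tau>) *
      dilog (cis (2 * pi * (of_int h * real c / real (gcd k M)))))) {1..}"
    (is "(?f has_sum ?A * dilog ?w) _")
proof -
  define g where "g = gcd k M"
  define K where "K = k div g"
  have g: "g > 0" "k = g * K" using k by (auto simp: g_def K_def)
  then have K: "K > 0" using k by auto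
  have dvd: "k dvd l * M \<longleftrightarrow> K dvd l" for l
  proof -
    have lM: "l * M = g * (l * (M div g))" by (simp add: g_def mult.left_commute)
    have "k dvd l * M \<longleftrightarrow> K dvd l * (M div g)"
      unfolding lM g(2) using g(1) by simp
    moreover have "coprime K (M div g)"
      unfolding K_def g_def using k by (intro div_gcd_coprime) auto
    then have "K dvd l * (M div g) \<longleftrightarrow> K dvd l" by (rule coprime_dvd_mult_left_iff)
    ultimately show ?thesis by (rule trans)
  qed
  have "((\<lambda>j. ?A * (?w ^ j / of_nat j ^ 2)) has_sum ?A * dilog ?w) {1..}"
    by (intro has_sum_cmult_right dilog_has_sum) simp
  also have "?this \<longleftrightarrow> ((?f \<circ> (\<lambda>j. K * j)) has_sum ?A * dilog ?w) {1..}"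
  proof (rule has_sum_cong)
    fix j :: nat assume j: "j \<in> {1..}"
    have "?w ^ j = cis (2 * pi * (of_int h * real (K * j * c) / real k))"
      unfolding Complex.DeMoivre g_def[symmetric] using g K by (simp add: field_simps)
    moreover have "?A / of_nat j ^ 2 = 1 / (of_nat (K * j) ^ 2 * of_nat M * \<tau>)"
      unfolding g_def[symmetric] using g K by (simp add: field_simps power2_eq_square)
    moreover have "k dvd K * j * M" by (simp add: dvd)
    moreover have "?A * (?w ^ j / of_nat j ^ 2) = ?w ^ j * (?A / of_nat j ^ 2)" by simp
    ultimately show "?A * (?w ^ j / of_nat j ^ 2) = (?f \<circ> (\<lambda>j. K * j)) j"
      by (simp only: o_def if_True) simp
  qed
  also have "\<dots> \<longleftrightarrow> (?f has_sum ?A * dilog ?w) ((\<lambda>j. K * j) ` {1..})"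
    using K by (intro has_sum_reindex[symmetric]) (auto simp: inj_on_def)
  also have "\<dots> \<longleftrightarrow> (?f has_sum ?A * dilog ?w) {1..}"
  proof (rule has_sum_cong_neutral)
    fix l assume "l \<in> {1..} - (\<lambda>j. K * j) ` {1..}"
    then have "\<not> K dvd l" by (auto elim!: dvdE)
    then show "?f l = 0" by (simp add: dvd)
  qed (use K in auto)
  finally show ?thesis .
qed

text \<open>As \<open>g\<close> divides \<open>M\<close>, the arguments for \<open>a\<close> and
  \<open>M - a\<close> are complex conjugates, so the sum is twice a real part. The congruence
  replaces the angle by that of \<open>b / g\<close>, which lies in the range of the closed formula;
  \<open>b = g\<close> gives the angle \<open>2 * pi\<close>.\<close>

lemma dilog_pair_sum:
  fixes h b :: int and a M g :: nat
  assumes a: "a \<le> M" and g: "g dvd M" "g > 0" and b: "1 \<le> b" "b \<le> int g" "[b = - h * int a] (mod int g)"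
  shows "dilog (cis (2 * pi * (of_int h * real a / real g))) +
      dilog (cis (2 * pi * (of_int h * real (M - a) / real g)))
    = of_real (pi\<^sup>2) * (2 * of_int b * (of_int b - of_nat g) / of_nat g ^ 2 + 1 / 3)"
proof -
  let ?w = "cis (2 * pi * (of_int b / real g))"
  obtain t where t: "b = - h * int a + int g * t"
    using b(3) by (metis cong_iff_lin cong_sym)
  have "- (of_int h * real a / real g) = of_int b / real g - of_int t"
    using g by (simp add: t field_simps)
  then have "cis (2 * pi * - (of_int h * real a / real g)) = ?w"
    by (simp add: right_diff_distrib flip: cis_divide)
  moreover have "cis (2 * pi * x) = cnj (cis (2 * pi * - x))" for x
    by (simp add: cis_cnj)
  ultimately have wa: "cis (2 * pi * (of_int h * real a / real g)) = cnj ?w"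
    by metis
  obtain u where u: "M = g * u" using g by (elim dvdE)
  have "real (M - a) = real g * real u - real a" using a u by (simp add: of_nat_diff)
  then have "of_int h * real (M - a) / real g = of_int h * real u - of_int h * real a / real g"
    using g by (simp add: diff_divide_distrib right_diff_distrib)
  moreover have "cis (2 * pi * (of_int h * real u)) = 1"
    by (intro cis_multiple_2pi Ints_mult) auto
  ultimately have "cis (2 * pi * (of_int h * real (M - a) / real g)) =
      cnj (cis (2 * pi * (of_int h * real a / real g)))"
    by (simp add: right_diff_distrib cis_cnj flip: cis_divide cis_inverse) (simp add: inverse_eq_divide)
  then have "dilog (cis (2 * pi * (of_int h * real a / real g))) +
      dilog (cis (2 * pi * (of_int h * real (M - a) / real g)))
    = dilog ?w + cnj (dilog ?w)"
    unfolding wa by (simp add: dilog_cnj)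
  also have "\<dots> = of_real (2 * Re (dilog ?w))" by (simp only: complex_add_cnj)
  finally have pair: "dilog (cis (2 * pi * (of_int h * real a / real g))) +
      dilog (cis (2 * pi * (of_int h * real (M - a) / real g)))
    = of_real (2 * Re (dilog ?w))" .
  have "of_int b / real g \<le> 1" using b g by (simp add: le_divide_eq_1)
  then have "Re (dilog ?w) =
      (2 * pi * (of_int b / real g))\<^sup>2 / 4 - pi * (2 * pi * (of_int b / real g)) / 2 + pi\<^sup>2 / 6"
    using b g mult_left_mono[of "of_int b / real g" 1 "2 * pi"] by (intro Re_dilog_cis) auto
  then have "2 * Re (dilog ?w) = pi\<^sup>2 * (2 * of_int b * (of_int b - real g) / real g ^ 2 + 1 / 3)"
    using g by (simp add: field_simps power2_eq_square)
  then show ?thesis unfolding pair by simp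
qed

text \<open>The estimate for one series is applied with \<open>c = a\<close> and
  \<open>c = M - a\<close>; the two errors account for the factor 2, which matches the
  \<open>2 * E1\<close> of the final statement.\<close>

lemma Psi_pair_approx:
  fixes X Y :: real and \<tau> q :: complex and h b :: int and k M a N :: nat
  assumes X: "X > 0" and k: "k > 0" "k \<le> N" and M: "M > 0" and a: "a \<le> M"
    and hk: "coprime h (int k)"
    and Y: "\<bar>Y\<bar> \<le> 1 / (real k * real N)" and N: "real N ^ 2 \<le> 2 * pi * X"
    and \<tau>: "Re \<tau> = 1 / X" "Im \<tau> = 2 * pi * Y"
    and q: "q = exp (- \<tau> + 2 * complex_of_real pi * \<i> * of_int h / of_nat k)"
    and b: "1 \<le> b" "b \<le> int (gcd k M)" "[b = - h * int a] (mod int (gcd k M))"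
  shows "norm (Psi a M q + Psi (M - a) M q - complex_of_real pi ^ 2 / \<tau>
                * (of_nat (gcd k M) ^ 2 / (of_nat k ^ 2 * of_nat M))
                * (2 * of_int b * (of_int b - of_nat (gcd k M)) / of_nat (gcd k M) ^ 2 + 1 / 3))
     \<le> 2 * (8 * real N * (1 + ln (real N)) + 128 * real M * X / real N)" (is "norm (_ + _ - ?P) \<le> 2 * ?B")
proof -
  define S where "S = (\<lambda>c. of_nat (gcd k M) ^ 2 / (of_nat k ^ 2 * of_nat M * \<tau>) *
      dilog (cis (2 * pi * (of_int h * real c / real (gcd k M)))))"
  have est: "norm (Psi c M q - S c) \<le> ?B" if "c \<le> M" for c
    unfolding S_def
    by (rule Psi_approx[OF X k M that hk Y N \<tau> q resonant_terms_has_sum[OF k(1)]])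
  have "S a + S (M - a) = of_nat (gcd k M) ^ 2 / (of_nat k ^ 2 * of_nat M * \<tau>) *
      (of_real (pi\<^sup>2) * (2 * of_int b * (of_int b - of_nat (gcd k M)) / of_nat (gcd k M) ^ 2 + 1 / 3))"
    unfolding S_def distrib_left[symmetric] using k M
    by (subst dilog_pair_sum[OF a _ _ b]) auto
  also have "\<dots> = ?P" by (simp add: mult_ac)
  finally have "Psi a M q + Psi (M - a) M q - ?P = (Psi a M q - S a) + (Psi (M - a) M q - S (M - a))"
    by (simp add: algebra_simps)
  also have "norm \<dots> \<le> ?B + ?B"
    by (intro norm_triangle_mono est a) simp
  also have "\<dots> = 2 * ?B" by simp
  finally show ?thesis .
qed

section \<open>Size of the error term in \<open>X\<close>, and the final assembly\<close>

text \<open>From \<open>4 \<le> 2 * pi \<le> 9\<close>, and since \<open>sqrt X \<ge> 4\<close>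
  absorbs the loss from the floor, \<open>N\<close> lies between \<open>sqrt X\<close> and
  \<open>3 * sqrt X\<close>. The constant 48 is \<open>8 * 3 * 2\<close>.\<close>

lemma error_bound_le:
  fixes X :: real and M N :: nat
  assumes X: "X \<ge> 16" and N: "int N = \<lfloor>sqrt (2 * pi * X)\<rfloor>"
  shows "8 * real N * (1 + ln (real N)) + 128 * real M * X / real N \<le> (48 + 128 * real M) * (X powr (1/2) * ln X)"
proof -
  have s: "sqrt X \<ge> 4" using X by (intro real_le_rsqrt) auto
  have ss: "sqrt X * sqrt X = X" using X by simp
  have "real N \<le> sqrt (2 * pi * X)" "sqrt (2 * pi * X) < real N + 1" using N by linarith+
  moreover have "sqrt (2 * pi * X) \<le> 3 * sqrt X"
    using X pi_less_4 by (intro real_le_lsqrt) (auto simp: power_mult_distrib)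
  moreover have "2 * sqrt X \<le> sqrt (2 * pi * X)"
    using X pi_gt3 by (intro real_le_rsqrt) (auto simp: power_mult_distrib)
  ultimately have N1: "real N \<le> 3 * sqrt X" and N2: "sqrt X \<le> real N" using s by linarith+
  \<comment> \<open>This yields \<open>N \<le> X\<close>, hence
    \<open>ln N \<le> ln X\<close>.\<close>
  have "3 * sqrt X \<le> sqrt X * sqrt X" using s X by (intro mult_right_mono) auto
  then have "ln (real N) \<le> ln X" using N1 N2 s ss by (subst ln_le_cancel_iff) auto
  moreover have "ln X \<ge> 1" using X exp_le by (subst ln_ge_iff) auto
  ultimately have "8 * real N * (1 + ln (real N)) \<le> 8 * (3 * sqrt X) * (2 * ln X)"
    using N1 N2 s X \<open>ln (real N) \<le> ln X\<close> \<open>ln X \<ge> 1\<close>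
    by (intro mult_mono) (simp_all del: ln_le_cancel_iff)
  moreover have "128 * real M * X / real N \<le> 128 * real M * X / sqrt X"
    using N2 s X by (intro divide_left_mono) auto
  moreover have "128 * real M * X / sqrt X = 128 * real M * sqrt X * 1"
    using X real_div_sqrt[of X] by (simp flip: times_divide_eq_right)
  moreover have "128 * real M * sqrt X * 1 \<le> 128 * real M * sqrt X * ln X"
    using \<open>ln X \<ge> 1\<close> X by (intro mult_left_mono) auto
  ultimately show ?thesis using X by (simp add: powr_half_sqrt algebra_simps)
qed

theorem theorem1p11:
  shows "\<exists>X0::real. X0 \<ge> 16 \<and>
    (\<forall>M::nat. M > 0 \<longrightarrow> (\<exists>C::real. C > 0 \<and>
      (\<forall>(a::nat) (X::real) (h::int) (k1::int) (Y::real) (b::int) (N::int) (\<tau>::complex) (q::complex).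
         1 \<le> a \<and> real a < real M / 2 \<and> coprime a M \<and>
         X \<ge> X0 \<and> N = \<lfloor>sqrt (2 * pi * X)\<rfloor> \<and>
         1 \<le> h \<and> h \<le> k1 \<and> k1 \<le> N \<and> coprime h k1 \<and>
         \<bar>Y\<bar> \<le> 1 / (real_of_int k1 * real_of_int N) \<and>
         \<tau> = 1 / complex_of_real X + 2 * complex_of_real pi * \<i> * complex_of_real Y \<and>
         q = exp (- \<tau> + 2 * complex_of_real pi * \<i> * of_int h / of_int k1) \<and>
         1 \<le> b \<and> b \<le> gcd k1 (int M) \<and> [b = - h * int a] (mod gcd k1 (int M))
         \<longrightarrow>
         (\<exists>E1::complex.
            Psi a M q + Psi (M - a) M q =
              complex_of_real pi ^ 2 / \<tau>
                * (of_int (gcd k1 (int M)) ^ 2 / (of_int k1 ^ 2 * of_nat M))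
                * (2 * of_int b * (of_int b - of_int (gcd k1 (int M))) / of_int (gcd k1 (int M)) ^ 2
                   + 1 / 3)
              + 2 * E1 \<and>
            \<bar>Re E1\<bar> \<le> C * (X powr (1/2) * ln X)))))"
\<comment> \<open>All estimates hold from \<open>X = 16\<close> on, so the threshold is the same for
  every \<open>M\<close>; only \<open>C\<close> varies with \<open>M\<close>.\<close>
proof (rule exI[of _ 16], rule conjI[OF order.refl], intro allI impI)
  fix M :: nat assume M: "M > 0"
  show "\<exists>C::real. C > 0 \<and>
      (\<forall>(a::nat) (X::real) (h::int) (k1::int) (Y::real) (b::int) (N::int) (\<tau>::complex) (q::complex).
         1 \<le> a \<and> real a < real M / 2 \<and> coprime a M \<and>
         X \<ge> 16 \<and> N = \<lfloor>sqrt (2 * pi * X)\<rfloor> \<and>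
         1 \<le> h \<and> h \<le> k1 \<and> k1 \<le> N \<and> coprime h k1 \<and>
         \<bar>Y\<bar> \<le> 1 / (real_of_int k1 * real_of_int N) \<and>
         \<tau> = 1 / complex_of_real X + 2 * complex_of_real pi * \<i> * complex_of_real Y \<and>
         q = exp (- \<tau> + 2 * complex_of_real pi * \<i> * of_int h / of_int k1) \<and>
         1 \<le> b \<and> b \<le> gcd k1 (int M) \<and> [b = - h * int a] (mod gcd k1 (int M))
         \<longrightarrow>
         (\<exists>E1::complex.
            Psi a M q + Psi (M - a) M q =
              complex_of_real pi ^ 2 / \<tau>
                * (of_int (gcd k1 (int M)) ^ 2 / (of_int k1 ^ 2 * of_nat M))
                * (2 * of_int b * (of_int b - of_int (gcd k1 (int M))) / of_int (gcd k1 (int M)) ^ 2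
                   + 1 / 3)
              + 2 * E1 \<and>
            \<bar>Re E1\<bar> \<le> C * (X powr (1/2) * ln X)))"
  proof (rule exI[of _ "48 + 128 * real M"], intro conjI allI impI; (elim conjE)?)
    fix a :: nat and X :: real and h k1 :: int and Y :: real and b N :: int and \<tau> q :: complex
    assume a: "real a < real M / 2" and X: "X \<ge> 16" and N: "N = \<lfloor>sqrt (2 * pi * X)\<rfloor>"
      and h: "1 \<le> h" "h \<le> k1" and k1: "k1 \<le> N" and hk: "coprime h k1"
      and Y: "\<bar>Y\<bar> \<le> 1 / (real_of_int k1 * real_of_int N)"
      and \<tau>: "\<tau> = 1 / complex_of_real X + 2 * complex_of_real pi * \<i> * complex_of_real Y"
      and q: "q = exp (- \<tau> + 2 * complex_of_real pi * \<i> * of_int h / of_int k1)"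
      and b: "1 \<le> b" "b \<le> gcd k1 (int M)" "[b = - h * int a] (mod gcd k1 (int M))"
    \<comment> \<open>The estimates use natural numbers; \<open>1 \<le> h \<le> k1 \<le> N\<close>
      makes the conversion lossless.\<close>
    define k n where "k = nat k1" and "n = nat N"
    have k_eq: "k1 = int k" and n_eq: "N = int n" using h k1 by (auto simp: k_def n_def)
    have "real n \<le> sqrt (2 * pi * X)" using N n_eq by linarith
    then have "real n ^ 2 \<le> sqrt (2 * pi * X) ^ 2" by (intro power_mono) auto
    then have n: "real n ^ 2 \<le> 2 * pi * X" using X by simp
    let ?P = "complex_of_real pi ^ 2 / \<tau> * (of_nat (gcd k M) ^ 2 / (of_nat k ^ 2 * of_nat M))
                * (2 * of_int b * (of_int b - of_nat (gcd k M)) / of_nat (gcd k M) ^ 2 + 1 / 3)"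
    have "norm (Psi a M q + Psi (M - a) M q - ?P) 
        \<le> 2 * (8 * real n * (1 + ln (real n)) + 128 * real M * X / real n)"
    proof (rule Psi_pair_approx[where X = X and Y = Y and h = h and N = n])
      have "Re (1 / complex_of_real X) = 1 / X" "Im (1 / complex_of_real X) = 0"
        using Re_complex_of_real[of "1 / X"] Im_complex_of_real[of "1 / X"]
        by (simp_all only: of_real_divide of_real_1)
      then show "Re \<tau> = 1 / X" "Im \<tau> = 2 * pi * Y" by (simp_all add: \<tau>)
      show "coprime h (int k)" using hk by (simp only: k_eq)
      show "\<bar>Y\<bar> \<le> 1 / (real k * real n)" using Y by (simp only: k_eq n_eq of_int_of_nat_eq)
      show "q = exp (- \<tau> + 2 * complex_of_real pi * \<i> * of_int h / of_nat k)"
        using q by (simp only: k_eq of_int_of_nat_eq)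
      show "b \<le> int (gcd k M)" "[b = - h * int a] (mod int (gcd k M))"
        using b by (simp_all only: k_eq gcd_int_int_eq)
      show "k > 0" "k \<le> n" "X > 0" "a \<le> M" using h k1 X a by (simp_all add: k_eq n_eq)
    qed (fact M n b(1))+
    also have "\<dots> \<le> 2 * ((48 + 128 * real M) * (X powr (1/2) * ln X))"
      using error_bound_le[OF X, of n M] N n_eq by simp
    finally have bd: "norm ((Psi a M q + Psi (M - a) M q - ?P) / 2) \<le> (48 + 128 * real M) * (X powr (1/2) * ln X)"
      by (simp add: norm_divide)
    have P_eq: "?P = complex_of_real pi ^ 2 / \<tau>
                * (of_int (gcd k1 (int M)) ^ 2 / (of_int k1 ^ 2 * of_nat M))
                * (2 * of_int b * (of_int b - of_int (gcd k1 (int M))) / of_int (gcd k1 (int M)) ^ 2 + 1 / 3)"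
      by (simp add: k_eq)
    show "\<exists>E1::complex.
            Psi a M q + Psi (M - a) M q =
              complex_of_real pi ^ 2 / \<tau>
                * (of_int (gcd k1 (int M)) ^ 2 / (of_int k1 ^ 2 * of_nat M))
                * (2 * of_int b * (of_int b - of_int (gcd k1 (int M))) / of_int (gcd k1 (int M)) ^ 2
                   + 1 / 3)
              + 2 * E1 \<and>
            \<bar>Re E1\<bar> \<le> (48 + 128 * real M) * (X powr (1/2) * ln X)"
    \<comment> \<open>\<open>E1\<close> is half the difference between the two sides; its modulus is
      already bounded, and the real part is no larger.\<close>
    proof (intro exI conjI)
      have "x = p + 2 * ((x - p) / 2)" for x p :: complex by (simp add: field_simps)
      then show "Psi a M q + Psi (M - a) M q = complex_of_real pi ^ 2 / \<tau>
                * (of_int (gcd k1 (int M)) ^ 2 / (of_int k1 ^ 2 * of_nat M))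
                * (2 * of_int b * (of_int b - of_int (gcd k1 (int M))) / of_int (gcd k1 (int M)) ^ 2
                   + 1 / 3) + 2 * ((Psi a M q + Psi (M - a) M q - ?P) / 2)"
        unfolding P_eq .
      show "\<bar>Re ((Psi a M q + Psi (M - a) M q - ?P) / 2)\<bar> \<le> (48 + 128 * real M) * (X powr (1/2) * ln X)"
        by (rule order.trans[OF abs_Re_le_cmod bd])
    qed
  qed simp
qed

end
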